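(* Let $m\ge1$ and let $W\in C^2(\mathbb{R}^m\times\mathbb{R}^m;[0,\infty))$, $W=W(u,v)$. Assume that $A:=\{u\in\mathbb{R}^m: W(u,0)=0\}=\{a_1,\ldots,a_N\}$ is a finite set with $N\ge2$ elements; given $a^-\in A$, set $A^-=\{a^-\}$ and $A^+=A\setminus\{a^-\}$. Assume further: (H2) there exists an open set $\Omega\subset\mathbb{R}^m$ such that $A^-\subset\Omega$, $A^+\cap\overline{\Omega}=\emptyset$, and $W(u,v)>0$ for every $u\in\partial\Omega$ and every $v\in\mathbb{R}^m$; (H3) $\liminf_{|u|\to\infty}W(u,v)>0$ uniformly in $v\in\mathbb{R}^m$. Fix such an $\Omega$, let $q\in\big(0,\tfrac{d(A^-,A^+)}{2}\big)$ be such that $\{u: d(u,A^-)\le q\}\subset\Omega$ and $\{u: d(u,A^+)\le q\}\cap\overline{\Omega}=\emptyset$, and let $\bar u\in\mathcal{A}$ be a minimizer of $J_{\mathbb{R}}$ over $\mathcal{A}$ satisfying properties (i)-(iv) listed in the context (such a minimizer exists). Then there exists $a^+\in A^+$ such that $$\lim_{x\to-\infty}\bar u(x)=a^-\quad\text{and}\quad\lim_{x\to+\infty}\bar u(x)=a^+.$$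
   Context: $d$ is the Euclidean distance in $\mathbb{R}^m$. For $u\in W^{2,2}_{\mathrm{loc}}(\mathbb{R};\mathbb{R}^m)$ (identified with its $C^1$ representative), $$J_{\mathbb{R}}(u)=\int_{\mathbb{R}}\Big(\tfrac12|u''|^2+W(u,u')\Big)dx\in[0,+\infty].$$ The class $\mathcal{A}$ is the set of all $u\in W^{2,2}_{\mathrm{loc}}(\mathbb{R};\mathbb{R}^m)$ for which there exist real numbers $x_u^-<x_u^+$ (depending on $u$) with $d(u(x),A^-)\le q$ for all $x\le x_u^-$ and $d(u(x),A^+)\le q$ for all $x\ge x_u^+$. Under the stated hypotheses there is $\bar u\in\mathcal{A}$ with $J_{\mathbb{R}}(\bar u)=\min_{\mathcal{A}}J_{\mathbb{R}}<+\infty$ and: (i) $\bar u\in C^4(\mathbb{R};\mathbb{R}^m)$ solves $u''''+W_u(u,u')-\frac{d}{dx}W_v(u,u')=0$, where $W_u,W_v$ are the gradients of $W$ in the first and second variable; (ii) $\lim_{x\to\pm\infty}d(\bar u(x),A^\pm)=0$; (iii) $\lim_{x\to\pm\infty}(\bar u'(x),\bar u''(x),\bar u'''(x))=(0,0,0)$; (iv) $\frac12|\bar u''|^2-W(\bar u,\bar u')+W_v(\bar u,\bar u')\cdot\bar u'-\bar u'''\cdot\bar u'\equiv0$ on $\mathbb{R}$. *)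

theory Defs
  imports "HOL-Analysis.Analysis"
begin

subsection \<open>Functions of class \<open>C\<^sup>k\<close>\<close>

definition nth_vderiv :: "nat \<Rightarrow> (real \<Rightarrow> 'a::real_normed_vector) \<Rightarrow> real \<Rightarrow> 'a" where
  "nth_vderiv k u = ((\<lambda>f x. vector_derivative f (at x)) ^^ k) u"

definition C_k :: "nat \<Rightarrow> (real \<Rightarrow> 'a::real_normed_vector) \<Rightarrow> bool" where
  "C_k k u \<longleftrightarrow> (\<forall>j<k. \<forall>x. nth_vderiv j u differentiable at x) \<and> continuous_on UNIV (nth_vderiv k u)"

definition C_2 :: "('b::real_normed_vector \<Rightarrow> 'c::real_normed_vector) \<Rightarrow> bool" where
  "C_2 f \<longleftrightarrow> (\<exists>(f' :: 'b \<Rightarrow> 'b \<Rightarrow>\<^sub>L 'c) (f'' :: 'b \<Rightarrow> 'b \<Rightarrow>\<^sub>L 'b \<Rightarrow>\<^sub>L 'c).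
     (\<forall>z. (f has_derivative blinfun_apply (f' z)) (at z)) \<and>
     (\<forall>z. (f' has_derivative blinfun_apply (f'' z)) (at z)) \<and>
     continuous_on UNIV f'')"

definition grad :: "('a::real_inner \<Rightarrow> real) \<Rightarrow> 'a \<Rightarrow> 'a" where
  "grad f x = (THE D. GDERIV f x :> D)"

definition W_u :: "('a::real_inner \<times> 'a \<Rightarrow> real) \<Rightarrow> 'a \<times> 'a \<Rightarrow> 'a" where
  "W_u W = (\<lambda>(u, v). grad (\<lambda>p. W (p, v)) u)"

definition W_v :: "('a::real_inner \<times> 'a \<Rightarrow> real) \<Rightarrow> 'a \<times> 'a \<Rightarrow> 'a" where
  "W_v W = (\<lambda>(u, v). grad (\<lambda>p. W (u, p)) v)"

subsection \<open>The space \<open>W\<^sup>2\<^sup>,\<^sup>2\<^sub>l\<^sub>o\<^sub>c\<close> on the real line\<close>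

definition test_function :: "(real \<Rightarrow> real) \<Rightarrow> bool" where
  "test_function \<phi> \<longleftrightarrow> (\<forall>k. C_k k \<phi>) \<and> compact (closure {x. \<phi> x \<noteq> 0})"

definition L2_loc :: "(real \<Rightarrow> 'a::euclidean_space) \<Rightarrow> bool" where
  "L2_loc f \<longleftrightarrow> f \<in> borel_measurable lborel \<and>
     (\<forall>K. compact K \<longrightarrow> set_integrable lborel K (\<lambda>x. (norm (f x))\<^sup>2))"

definition has_weak_deriv ::
    "nat \<Rightarrow> (real \<Rightarrow> 'a::euclidean_space) \<Rightarrow> (real \<Rightarrow> 'a) \<Rightarrow> bool" where
  "has_weak_deriv k u g \<longleftrightarrow> (\<forall>\<phi>. test_function \<phi> \<longrightarrow>
     (LINT x|lborel. nth_vderiv k \<phi> x *\<^sub>R u x) = (-1) ^ k *\<^sub>R (LINT x|lborel. \<phi> x *\<^sub>R g x))"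

text \<open>
  An element of the Sobolev space is represented by its unique \<open>C\<^sup>1\<close> representative, so
  membership includes the requirement that the function itself is of class \<open>C\<^sup>1\<close>.
\<close>

definition W22_loc :: "(real \<Rightarrow> 'a::euclidean_space) set" where
  "W22_loc = {u. C_k 1 u \<and> L2_loc u \<and>
     (\<exists>g. L2_loc g \<and> has_weak_deriv 1 u g) \<and> (\<exists>g. L2_loc g \<and> has_weak_deriv 2 u g)}"

text \<open>
  The second weak derivative is determined only up to null sets; the choice made here does
  not affect the energy below.
\<close>

definition weak_deriv2 :: "(real \<Rightarrow> 'a::euclidean_space) \<Rightarrow> real \<Rightarrow> 'a" where
  "weak_deriv2 u = (SOME g. L2_loc g \<and> has_weak_deriv 2 u g)"

subsection \<open>The energy and the admissible class\<close>

definition energy :: "('a::euclidean_space \<times> 'a \<Rightarrow> real) \<Rightarrow> (real \<Rightarrow> 'a) \<Rightarrow> ennreal" where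
  "energy W u = (\<integral>\<^sup>+ x. ennreal ((1 / 2) * (norm (weak_deriv2 u x))\<^sup>2
     + W (u x, nth_vderiv 1 u x)) \<partial>lborel)"

definition admissible :: "'a::euclidean_space set \<Rightarrow> 'a set \<Rightarrow> real \<Rightarrow> (real \<Rightarrow> 'a) set" where
  "admissible Am Ap q = {u \<in> W22_loc. \<exists>xm xp. xm < xp \<and>
     (\<forall>x\<le>xm. infdist (u x) Am \<le> q) \<and> (\<forall>x\<ge>xp. infdist (u x) Ap \<le> q)}"

definition solves_EL :: "('a::euclidean_space \<times> 'a \<Rightarrow> real) \<Rightarrow> (real \<Rightarrow> 'a) \<Rightarrow> bool" where
  "solves_EL W u \<longleftrightarrow> (\<forall>x. nth_vderiv 4 u x + W_u W (u x, nth_vderiv 1 u x)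
     - vector_derivative (\<lambda>y. W_v W (u y, nth_vderiv 1 u y)) (at x) = 0)"

end

theory Submission
  imports Defs
begin

text \<open>
  A curve approaching a finite set eventually stays in a union of disjoint balls around its points;
  by connectedness it stays in one of them, and so converges to the centre of that ball.
\<close>

lemma tendsto_point_of_finite_set_at_top:
  fixes f :: "real \<Rightarrow> 'a::heine_borel"
  assumes cont: "continuous_on UNIV f" and S: "finite S" "S \<noteq> {}"
    and lim: "((\<lambda>x. infdist (f x) S) \<longlongrightarrow> 0) at_top"
  shows "\<exists>a\<in>S. (f \<longlongrightarrow> a) at_top"
proof -
  \<comment> \<open>Finiteness gives one separation constant \<open>e\<close> for all pairs of
    points of \<open>S\<close>, so balls of a single radius suffice below.\<close>
  have "uniform_discrete S"
    using uniform_discrete_finite_iff[of S] S(1) by blast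
  then obtain e where e: "e > 0" and sep: "\<And>a b. a \<in> S \<Longrightarrow> b \<in> S \<Longrightarrow> dist a b < e \<Longrightarrow> a = b"
    unfolding uniform_discrete_def by blast
  \<comment> \<open>The radius \<open>e / 2\<close> is half the separation: two centres this close
    to a common \<open>y\<close> are less than \<open>e\<close> apart. This serves twice, for
    disjoint balls and for identifying the nearest point.\<close>
  have near_unique: "a = b" if "a \<in> S" "b \<in> S" "dist a y < e / 2" "dist b y < e / 2" for a b y
    using sep[OF that(1,2)] that(3,4) dist_triangle2[of a b y] by auto
  have "eventually (\<lambda>x. infdist (f x) S < e / 2) at_top"
    using order_tendstoD(2)[OF lim, of "e / 2"] e by simp
  then obtain X where X: "\<And>x. x \<ge> X \<Longrightarrow> infdist (f x) S < e / 2"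
    unfolding eventually_at_top_linorder by blast
  have nearest: "\<exists>b\<in>S. infdist (f x) S = dist (f x) b" for x
    using infdist_attains_inf[OF finite_imp_closed[OF S(1)] S(2)] by metis
  obtain a where a: "a \<in> S" "dist a (f X) < e / 2"
    using nearest[of X] X[of X] by (auto simp: dist_commute)
  \<comment> \<open>The balls are grouped into two open sets, the one containing \<open>f X\<close>
    against all the others, to fit the two-set form of connectedness.\<close>
  let ?U = "ball a (e / 2)" and ?V = "\<Union>b\<in>S - {a}. ball b (e / 2)"
  have conn: "connected (f ` {X..})"
    by (intro connected_continuous_image continuous_on_subset[OF cont]) auto
  have cover: "f ` {X..} \<subseteq> ?U \<union> ?V"
  proof
    fix y assume "y \<in> f ` {X..}"
    then obtain x where x: "y = f x" "x \<ge> X" by auto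
    obtain b where b: "b \<in> S" "infdist (f x) S = dist (f x) b"
      using nearest by blast
    then have "dist b y < e / 2"
      using x X[of x] by (simp add: dist_commute)
    with b(1) show "y \<in> ?U \<union> ?V"
      by (cases "b = a") auto
  qed
  have disj: "?U \<inter> ?V = {}"
  proof -
    have False if "y \<in> ?U" "b \<in> S" "b \<noteq> a" "y \<in> ball b (e / 2)" for b y
      using near_unique[OF a(1) that(2), of y] that by simp
    then show ?thesis by blast
  qed
  have "f X \<in> ?U \<inter> f ` {X..}"
    using a(2) by simp
  \<comment> \<open>The tail of the curve is connected, so it misses \<open>?U\<close> or
    \<open>?V\<close>; since \<open>f X\<close> lies in \<open>?U\<close>, it misses
    \<open>?V\<close>.\<close>
  moreover have "?U \<inter> f ` {X..} = {} \<or> ?V \<inter> f ` {X..} = {}"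
  proof (rule connectedD[OF conn _ _ _ cover])
    show "?U \<inter> ?V \<inter> f ` {X..} = {}"
      unfolding disj by simp
  qed (auto intro: open_UN)
  ultimately have sep_V: "?V \<inter> f ` {X..} = {}"
    by blast
  have stay: "dist a (f x) < e / 2" if "x \<ge> X" for x
  proof -
    have "f x \<in> f ` {X..}"
      using that by simp
    then have "f x \<in> ?U"
      using cover sep_V by blast
    then show ?thesis by simp
  qed
  \<comment> \<open>A nearest point of \<open>S\<close> and \<open>a\<close> are both within
    \<open>e / 2\<close> of \<open>f x\<close>, hence equal. On the tail the distance to
    \<open>S\<close> is thus the distance to \<open>a\<close>, which turns \<open>lim\<close> into
    convergence.\<close>
  have "infdist (f x) S = dist (f x) a" if "x \<ge> X" for x
  proof -
    obtain b where "b \<in> S" "infdist (f x) S = dist (f x) b"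
      using nearest by blast
    then show ?thesis
      using near_unique[OF a(1) _ stay[OF that]] X[OF that] by (auto simp: dist_commute)
  qed
  then have "eventually (\<lambda>x. infdist (f x) S = dist (f x) a) at_top"
    by (auto simp: eventually_at_top_linorder)
  then have "((\<lambda>x. dist (f x) a) \<longlongrightarrow> 0) at_top"
    using lim by (rule Lim_transform_eventually[rotated])
  then show ?thesis
    using a(1) tendsto_dist_iff[of f a at_top] by auto
qed

theorem corollary1p2:
  fixes W :: "(real ^ 'm) \<times> (real ^ 'm) \<Rightarrow> real"
    and A Am Ap \<Omega> :: "(real ^ 'm) set"
    and a_minus :: "real ^ 'm"
    and q :: real
    and ubar :: "real \<Rightarrow> real ^ 'm"
  assumes W_C2: "C_2 W"
    and W_nonneg: "\<And>u v. 0 \<le> W (u, v)"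
    and A_def: "A = {u. W (u, 0) = 0}"
    and A_finite: "finite A" and A_card: "card A \<ge> 2"
    and a_minus: "a_minus \<in> A"
    and Am_def: "Am = {a_minus}" and Ap_def: "Ap = A - {a_minus}"
    and H2: "open \<Omega>" "Am \<subseteq> \<Omega>" "Ap \<inter> closure \<Omega> = {}"
      "\<And>u v. u \<in> frontier \<Omega> \<Longrightarrow> W (u, v) > 0"
    and H3: "Liminf at_infinity (\<lambda>u. INF v. ereal (W (u, v))) > 0"
    and q: "0 < q" "q < setdist Am Ap / 2"
      "{u. infdist u Am \<le> q} \<subseteq> \<Omega>" "{u. infdist u Ap \<le> q} \<inter> closure \<Omega> = {}"
    and minimizer: "is_arg_min (energy W) (\<lambda>u. u \<in> admissible Am Ap q) ubar"
    and i: "C_k 4 ubar" "solves_EL W ubar"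
    and ii: "((\<lambda>x. infdist (ubar x) Am) \<longlongrightarrow> 0) at_bot"
      "((\<lambda>x. infdist (ubar x) Ap) \<longlongrightarrow> 0) at_top"
    and iii:
      "((\<lambda>x. (nth_vderiv 1 ubar x, nth_vderiv 2 ubar x, nth_vderiv 3 ubar x)) \<longlongrightarrow> (0, 0, 0)) at_bot"
      "((\<lambda>x. (nth_vderiv 1 ubar x, nth_vderiv 2 ubar x, nth_vderiv 3 ubar x)) \<longlongrightarrow> (0, 0, 0)) at_top"
    and iv: "\<And>x. (1 / 2) * (norm (nth_vderiv 2 ubar x))\<^sup>2 - W (ubar x, nth_vderiv 1 ubar x)
      + W_v W (ubar x, nth_vderiv 1 ubar x) \<bullet> nth_vderiv 1 ubar x
      - nth_vderiv 3 ubar x \<bullet> nth_vderiv 1 ubar x = 0"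
  shows "\<exists>a_plus\<in>Ap. (ubar \<longlongrightarrow> a_minus) at_bot \<and> (ubar \<longlongrightarrow> a_plus) at_top"
proof -
  \<comment> \<open>The case \<open>j = 0\<close> of \<open>C_k\<close>, where the iterated
    derivative is \<open>ubar\<close> itself.\<close>
  have "nth_vderiv 0 ubar differentiable at x" for x
    using i(1) by (simp add: C_k_def)
  then have cont: "continuous_on UNIV ubar"
    by (auto simp: nth_vderiv_def continuous_on_eq_continuous_at
        intro: differentiable_imp_continuous_within)
  \<comment> \<open>As \<open>infdist\<close> to the empty set is 0 by convention, the limit at
    \<open>at_top\<close> would say nothing if \<open>Ap\<close> were empty.\<close>
  have "Ap \<noteq> {}"
  proof
    assume "Ap = {}"
    then have "card A \<le> card {a_minus}"
      unfolding Ap_def by (intro card_mono) auto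
    with A_card show False by simp
  qed
  moreover have "finite Ap"
    using A_finite by (simp add: Ap_def)
  ultimately obtain a_plus where "a_plus \<in> Ap" "(ubar \<longlongrightarrow> a_plus) at_top"
    using tendsto_point_of_finite_set_at_top[OF cont _ _ ii(2)] by blast
  \<comment> \<open>For the singleton \<open>Am\<close>, \<open>infdist\<close> is the distance to
    \<open>a_minus\<close>, so no connectedness argument is involved.\<close>
  moreover have "(ubar \<longlongrightarrow> a_minus) at_bot"
    using ii(1) tendsto_dist_iff[of ubar a_minus at_bot] by (simp add: Am_def)
  ultimately show ?thesis by blast
qed

end
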